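(* Let $\mathcal{C}$ be a permutation class. The following are equivalent. (1) There exists a $\mathsf{TOTO}$ sentence $\psi$ such that for every $\sigma\in\mathcal{C}$, $\sigma\models\psi$ if and only if $\sigma$ has a fixed point. (2) There exists a $\mathsf{TOTO}$ formula $\phi(x)$ with one free variable such that for every $\sigma\in\mathcal{C}$ and every element $a$ of $\sigma$, $(\sigma,a)\models\phi(x)$ if and only if $a$ is a fixed point of $\sigma$. (3) There exist positive integers $k,m,n$ such that neither $\delta_k$ nor $321[\iota_m,1,\iota_n]$ belongs to $\mathcal{C}$.
   Context: A permutation $\sigma$ of size $N$ is identified with the finite structure whose domain is $A^\sigma=\{(i,\sigma(i)) : 1\le i\le N\}$, with position order $<_P$ (comparing first coordinates) and value order $<_V$ (comparing second coordinates); $\mathsf{TOTO}$ is first-order logic (with equality) over the signature $\{<_P,<_V\}$. An element $(i,\sigma(i))$ is a fixed point if $\sigma(i)=i$. A permutation $\sigma$ contains $\pi$ (as a pattern) if some subsequence of the one-line notation of $\sigma$ is order-isomorphic to $\pi$; a permutation class is a set of permutations closed under taking patterns. $\iota_n=12\cdots n$, $\delta_k=k\cdots21$. For $\pi$ of size $r$ and permutations $\sigma_1,\dots,\sigma_r$, the inflation $\pi[\sigma_1,\dots,\sigma_r]$ is obtained from the diagram of $\pi$ by replacing each point $(i,\pi(i))$ with the diagram of $\sigma_i$; thus $321[\iota_m,1,\iota_n]$ consists of an increasing sequence of length $m$, then a single point, then an increasing sequence of length $n$, each block lying entirely below the preceding ones. *)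

theory Defs
  imports Main "HOL-Library.Sublist" "HOL-Combinatorics.Multiset_Permutations"
begin

text \<open>
  A permutation of size \<open>N\<close> is represented by its one-line notation, a list of length \<open>N\<close> that
  arranges \<open>{1..N}\<close>. List indices start at \<open>0\<close>, positions and values at \<open>1\<close>. The empty
  permutation is allowed.
\<close>

definition is_perm :: "nat list \<Rightarrow> bool" where
  "is_perm \<sigma> \<longleftrightarrow> \<sigma> \<in> permutations_of_set {1..length \<sigma>}"

definition perm_at :: "nat list \<Rightarrow> nat \<Rightarrow> nat" where
  "perm_at \<sigma> i = \<sigma> ! (i - 1)"

definition elements :: "nat list \<Rightarrow> (nat \<times> nat) set" where
  "elements \<sigma> = {(i, perm_at \<sigma> i) | i. 1 \<le> i \<and> i \<le> length \<sigma>}"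

definition is_fixed_point :: "nat list \<Rightarrow> nat \<times> nat \<Rightarrow> bool" where
  "is_fixed_point \<sigma> a \<longleftrightarrow> a \<in> elements \<sigma> \<and> perm_at \<sigma> (fst a) = fst a"

definition order_isomorphic :: "nat list \<Rightarrow> nat list \<Rightarrow> bool" where
  "order_isomorphic xs ys \<longleftrightarrow> length xs = length ys \<and>
     (\<forall>i < length xs. \<forall>j < length xs. xs ! i < xs ! j \<longleftrightarrow> ys ! i < ys ! j)"

definition contains_pattern :: "nat list \<Rightarrow> nat list \<Rightarrow> bool" where
  "contains_pattern \<sigma> \<pi> \<longleftrightarrow> (\<exists>xs. subseq xs \<sigma> \<and> order_isomorphic xs \<pi>)"

definition permutation_class :: "nat list set \<Rightarrow> bool" where
  "permutation_class C \<longleftrightarrow> (\<forall>\<sigma>\<in>C. is_perm \<sigma>) \<and>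
     (\<forall>\<sigma>\<in>C. \<forall>\<pi>. is_perm \<pi> \<and> contains_pattern \<sigma> \<pi> \<longrightarrow> \<pi> \<in> C)"

definition iota :: "nat \<Rightarrow> nat list" where
  "iota n = [1..<Suc n]"

definition delta :: "nat \<Rightarrow> nat list" where
  "delta k = rev [1..<Suc k]"

text \<open>
  In \<open>\<pi>[\<sigma>\<^sub>1, \<dots>, \<sigma>\<^sub>r]\<close> the block replacing a point of \<open>\<pi>\<close> lies directly above the blocks replacing
  the points of \<open>\<pi>\<close> of smaller value, so it is shifted up by their total size.
\<close>

definition inflation :: "nat list \<Rightarrow> nat list list \<Rightarrow> nat list" where
  "inflation \<pi> \<sigma>s = concat (map (\<lambda>i.
     map (\<lambda>v. v + (\<Sum>j<length \<pi>. if \<pi> ! j < \<pi> ! i then length (\<sigma>s ! j) else 0)) (\<sigma>s ! i))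
     [0..<length \<pi>])"

text \<open>First-order formulas with equality over the two orders; variables are natural numbers.\<close>

datatype toto =
    Equal nat nat
  | PosLess nat nat
  | ValLess nat nat
  | Neg toto
  | Conj toto toto
  | Exists nat toto

primrec free_vars :: "toto \<Rightarrow> nat set" where
  "free_vars (Equal x y) = {x, y}"
| "free_vars (PosLess x y) = {x, y}"
| "free_vars (ValLess x y) = {x, y}"
| "free_vars (Neg \<phi>) = free_vars \<phi>"
| "free_vars (Conj \<phi> \<psi>) = free_vars \<phi> \<union> free_vars \<psi>"
| "free_vars (Exists x \<phi>) = free_vars \<phi> - {x}"

primrec sat :: "nat list \<Rightarrow> (nat \<Rightarrow> nat \<times> nat) \<Rightarrow> toto \<Rightarrow> bool" where
  "sat \<sigma> v (Equal x y) \<longleftrightarrow> v x = v y"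
| "sat \<sigma> v (PosLess x y) \<longleftrightarrow> fst (v x) < fst (v y)"
| "sat \<sigma> v (ValLess x y) \<longleftrightarrow> snd (v x) < snd (v y)"
| "sat \<sigma> v (Neg \<phi>) \<longleftrightarrow> \<not> sat \<sigma> v \<phi>"
| "sat \<sigma> v (Conj \<phi> \<psi>) \<longleftrightarrow> sat \<sigma> v \<phi> \<and> sat \<sigma> v \<psi>"
| "sat \<sigma> v (Exists x \<phi>) \<longleftrightarrow> (\<exists>a \<in> elements \<sigma>. sat \<sigma> (v(x := a)) \<phi>)"

lemma sat_cong:
  "(\<And>x. x \<in> free_vars \<phi> \<Longrightarrow> v x = w x) \<Longrightarrow> sat \<sigma> v \<phi> \<longleftrightarrow> sat \<sigma> w \<phi>"
proof (induction \<phi> arbitrary: v w)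
  case (Neg \<phi>)
  from Neg.prems have "sat \<sigma> v \<phi> = sat \<sigma> w \<phi>"
    by (intro Neg.IH) auto
  then show ?case by simp
next
  case (Conj \<phi> \<psi>)
  from Conj.prems have "sat \<sigma> v \<phi> = sat \<sigma> w \<phi>"
    by (intro Conj.IH(1)) auto
  moreover from Conj.prems have "sat \<sigma> v \<psi> = sat \<sigma> w \<psi>"
    by (intro Conj.IH(2)) auto
  ultimately show ?case by simp
next
  case (Exists y \<phi>)
  from Exists.prems have "sat \<sigma> (v(y := a)) \<phi> = sat \<sigma> (w(y := a)) \<phi>" for a
    by (intro Exists.IH) auto
  then show ?case by simp
qed simp_all

text \<open>
  By \<open>sat_cong\<close>, for a sentence the choice of assignment is irrelevant. Assignments range over the
  whole type \<open>nat \<times> nat\<close>, so that the quantification in \<open>models\<close> is not vacuous for the empty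
  permutation.
\<close>

definition is_sentence :: "toto \<Rightarrow> bool" where
  "is_sentence \<psi> \<longleftrightarrow> free_vars \<psi> = {}"

definition models :: "nat list \<Rightarrow> toto \<Rightarrow> bool" where
  "models \<sigma> \<psi> \<longleftrightarrow> (\<forall>v. sat \<sigma> v \<psi>)"

text \<open>\<open>models_at \<sigma> x a \<phi>\<close> is \<open>(\<sigma>, a) \<Turnstile> \<phi>(x)\<close>, for \<open>\<phi>\<close> with \<open>x\<close> as its only free variable.\<close>

definition models_at :: "nat list \<Rightarrow> nat \<Rightarrow> nat \<times> nat \<Rightarrow> toto \<Rightarrow> bool" where
  "models_at \<sigma> x a \<phi> \<longleftrightarrow> (\<forall>v. v x = a \<longrightarrow> sat \<sigma> v \<phi>)"

end

theory Submission
  imports Defs "HOL-Library.Ramsey"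
begin

text \<open>
  The difference \<open>\<sigma>(i) - i\<close> is the number of points to the lower right of \<open>(i, \<sigma>(i))\<close> minus the
  number of points to its upper left, so a fixed point is a point for which these numbers agree.
  If the class avoids \<open>\<delta>\<^sub>k\<close> and \<open>321[\<iota>\<^sub>m, 1, \<iota>\<^sub>n]\<close>, then by Ramsey's theorem one of the two regions
  has bounded size, and equality of the two numbers becomes first-order. Conversely, an
  Ehrenfeucht--Fraisse argument shows that no sentence distinguishes \<open>\<delta>\<^sub>k\<close> from \<open>\<delta>\<^bsub>k+1\<^esub>\<close>, or
  \<open>321[\<iota>\<^sub>m, 1, \<iota>\<^sub>m]\<close> from \<open>321[\<iota>\<^sub>m, 1, \<iota>\<^bsub>m+1\<^esub>]\<close>, for large \<open>k\<close> and \<open>m\<close>, although exactly one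
  permutation of each pair has a fixed point.
\<close>

section \<open>Permutations and patterns\<close>

lemma map_perm_at: "map (perm_at \<sigma>) [1..<Suc (length \<sigma>)] = \<sigma>"
  by (rule nth_equalityI) (auto simp: perm_at_def simp del: upt_Suc)

lemma bij_betw_perm_at:
  assumes "is_perm \<sigma>"
  shows "bij_betw (perm_at \<sigma>) {1..length \<sigma>} {1..length \<sigma>}"
proof -
  have "distinct (map (perm_at \<sigma>) [1..<Suc (length \<sigma>)])"
    and "set (map (perm_at \<sigma>) [1..<Suc (length \<sigma>)]) = {1..length \<sigma>}"
    using assms unfolding map_perm_at is_perm_def permutations_of_set_def by auto
  then show ?thesis
    unfolding bij_betw_def distinct_map set_map set_upt atLeastLessThanSuc_atLeastAtMost by blast
qed

lemma elements_eq: "elements \<sigma> = (\<lambda>i. (i, perm_at \<sigma> i)) ` {1..length \<sigma>}"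
  unfolding elements_def by auto

text \<open>A strictly increasing list is determined by its set, so \<open>ps\<close> is the
  interval filtered by membership in \<open>ps\<close>, and a filtered list is a
  subsequence.\<close>

lemma subseq_upt_of_sorted:
  assumes "sorted_wrt (<) ps" "set ps \<subseteq> {a..<b}"
  shows "subseq ps [a..<b]"
proof -
  have "ps = filter (\<lambda>x. x \<in> set ps) [a..<b]"
    using assms by (intro sorted_distinct_set_unique)
      (auto simp: strict_sorted_iff intro: sorted_wrt_filter)
  then show ?thesis by (metis subseq_filter_left)
qed

text \<open>Patterns are exhibited by increasing lists of positions: \<open>\<sigma>\<close> is the
  image of \<open>[1..<Suc (length \<sigma>)]\<close> under \<open>perm_at \<sigma>\<close>, and
  mapping preserves subsequences.\<close>

lemma contains_patternI:
  assumes "sorted_wrt (<) ps" "set ps \<subseteq> {1..length \<sigma>}" "length ps = length \<pi>"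
    and "\<And>i j. i < length \<pi> \<Longrightarrow> j < length \<pi> \<Longrightarrow>
      perm_at \<sigma> (ps ! i) < perm_at \<sigma> (ps ! j) \<longleftrightarrow> \<pi> ! i < \<pi> ! j"
  shows "contains_pattern \<sigma> \<pi>"
proof -
  have "subseq ps [1..<Suc (length \<sigma>)]"
    using assms(1,2) by (intro subseq_upt_of_sorted) auto
  then have "subseq (map (perm_at \<sigma>) ps) \<sigma>"
    using subseq_map map_perm_at by metis
  then show ?thesis
    unfolding contains_pattern_def order_isomorphic_def using assms(3,4)
    by (intro exI[of _ "map (perm_at \<sigma>) ps"]) simp
qed

section \<open>The two families of excluded patterns\<close>

lemma length_delta [simp]: "length (delta k) = k"
  by (simp add: delta_def)

lemma nth_delta: "i < k \<Longrightarrow> delta k ! i = k - i"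
  by (simp add: delta_def rev_nth del: upt_Suc)

lemma perm_at_delta: "i \<in> {1..k} \<Longrightarrow> perm_at (delta k) i = Suc k - i"
  by (auto simp: perm_at_def nth_delta)

lemma is_perm_delta: "is_perm (delta k)"
  by (auto simp: is_perm_def permutations_of_set_def delta_def)

lemma length_iota [simp]: "length (iota n) = n"
  by (simp add: iota_def)

definition infl321 :: "nat \<Rightarrow> nat \<Rightarrow> nat list" where
  "infl321 m n = inflation [3, 2, 1] [iota m, [1], iota n]"

lemma infl321_eq: "infl321 m n = map (\<lambda>v. v + Suc n) (iota m) @ Suc n # iota n"
  by (simp add: infl321_def inflation_def numeral_3_eq_3 lessThan_Suc)

lemma length_infl321 [simp]: "length (infl321 m n) = Suc (m + n)"
  by (simp add: infl321_eq iota_def del: upt_Suc)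

lemma nth_infl321:
  assumes "i < Suc (m + n)"
  shows "infl321 m n ! i =
    (if i < m then i + n + 2 else if i = m then Suc n else i - m)"
  using assms by (auto simp: infl321_eq iota_def nth_append nth_Cons' simp del: upt_Suc)

lemma is_perm_infl321: "is_perm (infl321 m n)"
proof -
  have "set (iota m) = {1..m}" for m by (auto simp: iota_def)
  moreover have "{1..Suc (m + n)} = (\<lambda>v. v + Suc n) ` {1..m} \<union> insert (Suc n) {1..n}"
    unfolding image_add_atLeastAtMost' by auto
  ultimately show ?thesis
    unfolding is_perm_def permutations_of_set_def length_infl321
    by (auto simp: infl321_eq distinct_map iota_def inj_on_def simp del: upt_Suc)
qed

lemma perm_at_infl321:
  assumes "i \<in> {1..Suc (m + n)}"
  shows "perm_at (infl321 m n) i =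
    (if i \<le> m then i + n + 1 else if i = Suc m then Suc n else i - Suc m)"
  using assms by (auto simp: perm_at_def nth_infl321)

text \<open>Two points form an increasing pair exactly when both lie strictly on the same side of
  the centre \<open>Suc m\<close>. The right-hand side mentions only position comparisons among
  \<open>p\<close>, \<open>q\<close> and the centre, so an order-preserving matching that respects
  the centre also preserves the value order.\<close>

lemma perm_at_infl321_less_iff:
  assumes "p \<in> {1..Suc (m + n)}" "q \<in> {1..Suc (m + n)}"
  shows "perm_at (infl321 m n) p < perm_at (infl321 m n) q \<longleftrightarrow>
    p < q \<and> (q < Suc m \<or> Suc m < p) \<or> q < p \<and> \<not> Suc m < q \<and> \<not> p < Suc m"
  unfolding perm_at_infl321[OF assms(1)] perm_at_infl321[OF assms(2)]
  using assms by (auto split: if_splits)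

section \<open>Indistinguishable permutations\<close>

primrec qrank :: "toto \<Rightarrow> nat" where
  "qrank (Equal x y) = 0"
| "qrank (PosLess x y) = 0"
| "qrank (ValLess x y) = 0"
| "qrank (Neg \<phi>) = qrank \<phi>"
| "qrank (Conj \<phi> \<psi>) = max (qrank \<phi>) (qrank \<psi>)"
| "qrank (Exists x \<phi>) = Suc (qrank \<phi>)"

text \<open>
  Subtraction is truncated and the pairs are taken in both orders, so for positive \<open>d\<close> the
  definition also says that \<open>R\<close> preserves and reflects the order.
\<close>

definition similar :: "nat \<Rightarrow> (nat \<times> nat) set \<Rightarrow> bool" where
  "similar d R \<longleftrightarrow> (\<forall>(a, b) \<in> R. \<forall>(a', b') \<in> R. min d (a' - a) = min d (b' - b))"

lemma similarD:
  "similar d R \<Longrightarrow> (a, b) \<in> R \<Longrightarrow> (a', b') \<in> R \<Longrightarrow> min d (a' - a) = min d (b' - b)"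
  unfolding similar_def by blast

lemma similar_less_iff:
  assumes "similar d R" "0 < d" "(a, b) \<in> R" "(a', b') \<in> R"
  shows "a < a' \<longleftrightarrow> b < b'"
  using similarD[OF assms(1,3,4)] assms(2) by (auto simp: min_def split: if_splits)

text \<open>Truncation at \<open>d'\<close> factors through truncation at any larger
  \<open>d\<close>.\<close>

lemma similar_mono:
  assumes "similar d R" "R' \<subseteq> R" "d' \<le> d"
  shows "similar d' R'"
proof -
  have "min d' x = min d' (min d x)" for x using assms(3) by (auto simp: min_def)
  then have "min d' (a' - a) = min d' (b' - b)" if "(a, b) \<in> R'" "(a', b') \<in> R'" for a b a' b'
    using similarD[OF assms(1), of a b a' b'] that assms(2) by (metis subsetD)
  then show ?thesis unfolding similar_def by blast
qed

lemma similar_converse: "similar d (R\<inverse>) \<longleftrightarrow> similar d R"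
proof -
  have "similar d (S\<inverse>)" if "similar d S" for S
    using similarD[OF that] by (auto simp: similar_def)
  from this[of R] this[of "R\<inverse>"] show ?thesis by auto
qed

text \<open>One round of the game. Only the nearest neighbours \<open>l\<close> and \<open>u\<close>
  of the new point matter, and their gap is known up to \<open>2 * d\<close>, which suffices to
  place a reply whose distances to both neighbours are correct up to \<open>d\<close>.\<close>

lemma similar_extend:
  assumes R: "similar (2 * d) R" "finite R" and d: "0 < d"
    and l0: "(l0, l0') \<in> R" "l0 \<le> a" and u0: "(u0, u0') \<in> R" "a \<le> u0"
  shows "\<exists>b. similar d (insert (a, b) R)"
proof (cases "a \<in> fst ` R")
  case True
  then obtain b where "(a, b) \<in> R" by auto
  then have "similar d (insert (a, b) R)" using R(1) by (auto simp: insert_absorb intro: similar_mono)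
  then show ?thesis ..
next
  case False
  define L where "L = {p \<in> fst ` R. p \<le> a}"
  define U where "U = {p \<in> fst ` R. a \<le> p}"
  have fin: "finite L" "finite U" using R(2) by (auto simp: L_def U_def)
  \<comment> \<open>The points \<open>l0\<close> and \<open>u0\<close> guarantee that both
    neighbours exist.\<close>
  have "L \<noteq> {}" "U \<noteq> {}" using l0 u0 by (force simp: L_def U_def)+
  then have "Max L \<in> L" "Min U \<in> U" using fin by auto
  then obtain l l' u u' where l: "(l, l') \<in> R" "l = Max L" and u: "(u, u') \<in> R" "u = Min U"
    unfolding L_def U_def by auto
  have "l \<noteq> a" "u \<noteq> a" using False l(1) u(1) by force+
  moreover have "l \<le> a" "a \<le> u"
    using \<open>Max L \<in> L\<close> \<open>Min U \<in> U\<close> l(2) u(2) unfolding L_def U_def by auto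
  ultimately have la: "l < a" "a < u" by auto
  have gap: "p \<le> l \<or> u \<le> p" if "(p, p') \<in> R" for p p'
  proof (cases "p \<le> a")
    case True
    then have "p \<in> L" using that by (force simp: L_def)
    then show ?thesis using fin l by auto
  next
    case False
    then have "p \<in> U" using that by (force simp: U_def)
    then show ?thesis using fin u by auto
  qed
  \<comment> \<open>A distance below \<open>d\<close> to a neighbour is copied exactly. If both
    distances are at least \<open>d\<close>, both gaps are at least \<open>2 * d\<close>, so
    \<open>l' + d\<close> is far enough from either end.\<close>
  define b where "b = (if a - l < d then l' + (a - l) else if u - a < d then u' - (u - a) else l' + d)"
  have lu: "min (2 * d) (u - l) = min (2 * d) (u' - l')" by (rule similarD[OF R(1) l(1) u(1)])
  have lb: "min d (a - l) = min d (b - l')" "min d (u - a) = min d (u' - b)" "l' < b" "b < u'"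
    using lu la d unfolding b_def by (auto simp: min_def split: if_splits)
  \<comment> \<open>The distance from \<open>a\<close> to a point beyond a neighbour is the distance
    to that neighbour plus a distance within \<open>R\<close>, and truncated summands determine the
    truncated sum.\<close>
  have add: "min d (x + y) = min d (x' + y')"
    if "min d x = min d x'" "min (2 * d) y = min (2 * d) y'" for x x' y y'
    using that by (auto simp: min_def split: if_splits)
  have ab: "min d (a - p) = min d (b - p') \<and> min d (p - a) = min d (p' - b)" if p: "(p, p') \<in> R" for p p'
    using gap[OF p]
  proof
    assume "p \<le> l"
    then have "p' \<le> l'" using similar_less_iff[OF R(1) _ l(1) p] d by auto
    moreover have "min (2 * d) (l - p) = min (2 * d) (l' - p')" by (rule similarD[OF R(1) p l(1)])
    ultimately show ?thesis using \<open>p \<le> l\<close> la lb(3) add[OF lb(1), of "l - p" "l' - p'"]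
      by simp
  next
    assume "u \<le> p"
    then have "u' \<le> p'" using similar_less_iff[OF R(1) _ p u(1)] d by auto
    moreover have "min (2 * d) (p - u) = min (2 * d) (p' - u')" by (rule similarD[OF R(1) u(1) p])
    ultimately show ?thesis using \<open>u \<le> p\<close> la lb(4) add[OF lb(2), of "p - u" "p' - u'"]
      by simp
  qed
  have "similar d R" using R(1) by (auto intro: similar_mono)
  then have "similar d (insert (a, b) R)"
    using ab unfolding similar_def by auto
  then show ?thesis ..
qed

text \<open>By \<open>val\<close> the value order can be read off from positions relative to
  \<open>B\<close>, so the game is played on positions alone. Each quantifier costs a factor 2 in
  the threshold, hence \<open>2 ^ qrank \<phi>\<close>. The pairs at \<open>0\<close> and
  \<open>Suc (length _)\<close> are sentinels just outside the permutations; \<open>B\<close> may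
  contain further marked positions.\<close>

lemma sat_iff_of_similar:
  assumes val: "\<And>p q p' q'. p \<in> {1..length \<sigma>} \<Longrightarrow> q \<in> {1..length \<sigma>} \<Longrightarrow>
      p' \<in> {1..length \<tau>} \<Longrightarrow> q' \<in> {1..length \<tau>} \<Longrightarrow> similar 1 (insert (p, p') (insert (q, q') B)) \<Longrightarrow>
      perm_at \<sigma> p < perm_at \<sigma> q \<longleftrightarrow> perm_at \<tau> p' < perm_at \<tau> q'"
    and B: "finite B" "(0, 0) \<in> B" "(Suc (length \<sigma>), Suc (length \<tau>)) \<in> B"
  shows "finite V \<Longrightarrow> free_vars \<phi> \<subseteq> V \<Longrightarrow>
    similar (2 ^ qrank \<phi>) (B \<union> (\<lambda>x. (fst (v x), fst (w x))) ` V) \<Longrightarrow>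
    \<forall>x \<in> V. v x \<in> elements \<sigma> \<and> w x \<in> elements \<tau> \<Longrightarrow> sat \<sigma> v \<phi> \<longleftrightarrow> sat \<tau> w \<phi>"
proof (induction \<phi> arbitrary: V v w)
  case (Equal x y)
  note R = Equal.prems(3)[unfolded qrank.simps] zero_less_power[OF zero_less_numeral]
  have "fst (v x) < fst (v y) \<longleftrightarrow> fst (w x) < fst (w y)" "fst (v y) < fst (v x) \<longleftrightarrow> fst (w y) < fst (w x)"
    by (rule similar_less_iff[OF R]; simp add: Equal.prems(2)[simplified])+
  then have "fst (v x) = fst (v y) \<longleftrightarrow> fst (w x) = fst (w y)" by linarith
  moreover have "v x \<in> elements \<sigma>" "v y \<in> elements \<sigma>" "w x \<in> elements \<tau>" "w y \<in> elements \<tau>"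
    using Equal.prems by auto
  ultimately show ?case by (auto simp: elements_eq)
next
  case (PosLess x y)
  note R = PosLess.prems(3)[unfolded qrank.simps] zero_less_power[OF zero_less_numeral]
  have "fst (v x) < fst (v y) \<longleftrightarrow> fst (w x) < fst (w y)"
    by (rule similar_less_iff[OF R]; simp add: PosLess.prems(2)[simplified])
  then show ?case by simp
next
  case (ValLess x y)
  have el: "v x \<in> elements \<sigma>" "v y \<in> elements \<sigma>" "w x \<in> elements \<tau>" "w y \<in> elements \<tau>"
    using ValLess.prems by auto
  have "similar 1 (insert (fst (v x), fst (w x)) (insert (fst (v y), fst (w y)) B))"
    using ValLess.prems by (auto intro: similar_mono)
  with val[of "fst (v x)" "fst (v y)" "fst (w x)" "fst (w y)"] el
  show ?case by (auto simp: elements_eq)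
next
  case (Neg \<phi>)
  then show ?case by simp
next
  case (Conj \<phi> \<psi>)
  have "similar (2 ^ qrank \<phi>) (B \<union> (\<lambda>x. (fst (v x), fst (w x))) ` V)"
    "similar (2 ^ qrank \<psi>) (B \<union> (\<lambda>x. (fst (v x), fst (w x))) ` V)"
    using Conj.prems(3) by (auto elim!: similar_mono intro: power_increasing)
  then show ?case using Conj.IH[of V v w] Conj.prems by simp
next
  case (Exists y \<phi>)
  let ?d = "2 ^ qrank \<phi> :: nat"
  \<comment> \<open>The old value of \<open>y\<close> is dropped because the quantifier rebinds
    \<open>y\<close>.\<close>
  define R where "R = B \<union> (\<lambda>x. (fst (v x), fst (w x))) ` (V - {y})"
  have R: "similar (2 * ?d) R" "finite R" "(0, 0) \<in> R" "(Suc (length \<sigma>), Suc (length \<tau>)) \<in> R"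
    using Exists.prems B unfolding R_def by (auto elim!: similar_mono)
  have step: "sat \<sigma> (v(y := (p, perm_at \<sigma> p))) \<phi> \<longleftrightarrow> sat \<tau> (w(y := (p', perm_at \<tau> p'))) \<phi>"
    if "similar ?d (insert (p, p') R)" "p \<in> {1..length \<sigma>}" "p' \<in> {1..length \<tau>}" for p p'
  proof (rule Exists.IH[of "insert y V"])
    have "B \<union> (\<lambda>x. (fst ((v(y := (p, perm_at \<sigma> p))) x), fst ((w(y := (p', perm_at \<tau> p'))) x))) ` insert y V
      \<subseteq> insert (p, p') R" unfolding R_def by auto
    then show "similar ?d (B \<union> (\<lambda>x. (fst ((v(y := (p, perm_at \<sigma> p))) x),
        fst ((w(y := (p', perm_at \<tau> p'))) x))) ` insert y V)"
      using similar_mono[OF that(1)] by blast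
  qed (use Exists.prems that in \<open>auto simp: elements_eq\<close>)
  \<comment> \<open>Lying strictly between the sentinels is preserved, so a reply is again a valid
    position.\<close>
  have range: "p \<in> {1..length \<sigma>} \<longleftrightarrow> p' \<in> {1..length \<tau>}" if "similar ?d (insert (p, p') R)" for p p'
    using similar_less_iff[OF that _ _ insertI1, of 0 0] R(3,4)
      similar_less_iff[OF that _ insertI1, of "Suc (length \<sigma>)" "Suc (length \<tau>)"] by auto
  have "\<exists>p' \<in> {1..length \<tau>}. similar ?d (insert (p, p') R)" if "p \<in> {1..length \<sigma>}" for p
  proof -
    have "0 < ?d" "0 \<le> p" "p \<le> Suc (length \<sigma>)" using that by auto
    from similar_extend[OF R(1,2) this(1) R(3) this(2) R(4) this(3)] range that
    show ?thesis by blast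
  qed
  \<comment> \<open>The other direction is the same extension step applied to the converse
    relation.\<close>
  moreover have "\<exists>p \<in> {1..length \<sigma>}. similar ?d (insert (p, p') R)" if "p' \<in> {1..length \<tau>}" for p'
  proof -
    have "similar (2 * ?d) (R\<inverse>)" "finite (R\<inverse>)" "(0, 0) \<in> R\<inverse>" "(Suc (length \<tau>), Suc (length \<sigma>)) \<in> R\<inverse>"
      using R by (auto simp: similar_converse)
    moreover have "0 < ?d" "0 \<le> p'" "p' \<le> Suc (length \<tau>)" using that by auto
    ultimately obtain p where "similar ?d (insert (p', p) (R\<inverse>))"
      using similar_extend by meson
    moreover have "insert (p', p) (R\<inverse>) = (insert (p, p') R)\<inverse>" by auto
    ultimately have "similar ?d (insert (p, p') R)" by (simp only: similar_converse)
    then show ?thesis using range that by blast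
  qed
  ultimately have "(\<exists>p \<in> {1..length \<sigma>}. sat \<sigma> (v(y := (p, perm_at \<sigma> p))) \<phi>) \<longleftrightarrow>
      (\<exists>p' \<in> {1..length \<tau>}. sat \<tau> (w(y := (p', perm_at \<tau> p'))) \<phi>)"
    using step by blast
  then show ?case by (simp add: elements_eq)
qed

lemma models_iff_of_similar:
  assumes "is_sentence \<psi>" "finite B" "(0, 0) \<in> B" "(Suc (length \<sigma>), Suc (length \<tau>)) \<in> B"
    and "similar (2 ^ qrank \<psi>) B"
    and "\<And>p q p' q'. p \<in> {1..length \<sigma>} \<Longrightarrow> q \<in> {1..length \<sigma>} \<Longrightarrow>
      p' \<in> {1..length \<tau>} \<Longrightarrow> q' \<in> {1..length \<tau>} \<Longrightarrow> similar 1 (insert (p, p') (insert (q, q') B)) \<Longrightarrow>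
      perm_at \<sigma> p < perm_at \<sigma> q \<longleftrightarrow> perm_at \<tau> p' < perm_at \<tau> q'"
  shows "models \<sigma> \<psi> \<longleftrightarrow> models \<tau> \<psi>"
proof -
  have "sat \<sigma> v \<psi> \<longleftrightarrow> sat \<tau> v \<psi>" for v
    using assms by (intro sat_iff_of_similar[where V = "{}"]) (auto simp: is_sentence_def)
  then show ?thesis by (simp add: models_def)
qed

section \<open>Two pairs of indistinguishable permutations\<close>

lemma models_delta_Suc_iff:
  assumes "is_sentence \<psi>" "2 ^ qrank \<psi> \<le> k"
  shows "models (delta k) \<psi> \<longleftrightarrow> models (delta (Suc k)) \<psi>"
\<comment> \<open>The value order is the reversed position order, so the sentinels suffice; their
  distances \<open>k + 1\<close> and \<open>k + 2\<close> both exceed the threshold.\<close>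
proof (rule models_iff_of_similar[where B = "{(0, 0), (Suc k, Suc (Suc k))}"])
  show "similar (2 ^ qrank \<psi>) {(0, 0), (Suc k, Suc (Suc k))}"
    using assms(2) by (auto simp: similar_def min_def)
next
  fix p q p' q'
  assume "similar 1 (insert (p, p') (insert (q, q') {(0, 0), (Suc k, Suc (Suc k))}))"
  then have "q < p \<longleftrightarrow> q' < p'" by (rule similar_less_iff) auto
  moreover assume "p \<in> {1..length (delta k)}" "q \<in> {1..length (delta k)}"
    "p' \<in> {1..length (delta (Suc k))}" "q' \<in> {1..length (delta (Suc k))}"
  ultimately show "perm_at (delta k) p < perm_at (delta k) q \<longleftrightarrow>
      perm_at (delta (Suc k)) p' < perm_at (delta (Suc k)) q'"
    by (auto simp: perm_at_delta)
qed (use assms in auto)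

lemma models_infl321_Suc_iff:
  assumes "is_sentence \<psi>" "2 ^ qrank \<psi> \<le> m"
  shows "models (infl321 m m) \<psi> \<longleftrightarrow> models (infl321 m (Suc m)) \<psi>"
\<comment> \<open>The centre \<open>Suc m\<close> is marked as well. The gaps to its left agree, and
  those to its right, \<open>m + 1\<close> and \<open>m + 2\<close>, both exceed the
  threshold.\<close>
proof (rule models_iff_of_similar[where B = "{(0, 0), (Suc m, Suc m), (Suc (Suc (m + m)), Suc (Suc (m + Suc m)))}"])
  let ?B = "{(0, 0), (Suc m, Suc m), (Suc (Suc (m + m)), Suc (Suc (m + Suc m)))}"
  show "similar (2 ^ qrank \<psi>) ?B"
    using assms(2) by (auto simp: similar_def min_def)
  fix p q p' q'
  let ?R = "insert (p, p') (insert (q, q') ?B)"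
  assume "similar 1 ?R"
  note less_iff = similar_less_iff[OF this zero_less_one]
  have "p < q \<longleftrightarrow> p' < q'" "q < p \<longleftrightarrow> q' < p'" "p < Suc m \<longleftrightarrow> p' < Suc m" "Suc m < p \<longleftrightarrow> Suc m < p'"
    "q < Suc m \<longleftrightarrow> q' < Suc m" "Suc m < q \<longleftrightarrow> Suc m < q'"
    by (rule less_iff; simp)+
  moreover assume "p \<in> {1..length (infl321 m m)}" "q \<in> {1..length (infl321 m m)}"
    "p' \<in> {1..length (infl321 m (Suc m))}" "q' \<in> {1..length (infl321 m (Suc m))}"
  ultimately show "perm_at (infl321 m m) p < perm_at (infl321 m m) q \<longleftrightarrow>
      perm_at (infl321 m (Suc m)) p' < perm_at (infl321 m (Suc m)) q'"
    unfolding length_infl321 by (simp only: perm_at_infl321_less_iff)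
qed (use assms in auto)

section \<open>Fixed points in the two families\<close>

lemma has_fixed_point_iff:
  "(\<exists>a \<in> elements \<sigma>. is_fixed_point \<sigma> a) \<longleftrightarrow> (\<exists>i \<in> {1..length \<sigma>}. perm_at \<sigma> i = i)"
  unfolding is_fixed_point_def elements_eq by auto

lemma has_fixed_point_delta_iff: "(\<exists>a \<in> elements (delta k). is_fixed_point (delta k) a) \<longleftrightarrow> odd k"
proof -
  have "(\<exists>a \<in> elements (delta k). is_fixed_point (delta k) a) \<longleftrightarrow> (\<exists>i \<in> {1..k}. k = 2 * i - 1)"
    unfolding has_fixed_point_iff length_delta by (rule bex_cong[OF refl]) (simp add: perm_at_delta, linarith)
  also have "\<dots> \<longleftrightarrow> odd k"
  proof
    assume "odd k"
    then obtain j where "k = 2 * j + 1" by (elim oddE)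
    then show "\<exists>i \<in> {1..k}. k = 2 * i - 1" by (intro bexI[of _ "Suc j"]) auto
  qed auto
  finally show ?thesis .
qed

text \<open>Points of the left block have value above their position and points of the right block
  below it, so only the centre, at position \<open>Suc m\<close> with value \<open>Suc n\<close>,
  can be fixed.\<close>

lemma has_fixed_point_infl321_iff:
  "(\<exists>a \<in> elements (infl321 m n). is_fixed_point (infl321 m n) a) \<longleftrightarrow> m = n"
proof -
  have "(\<exists>a \<in> elements (infl321 m n). is_fixed_point (infl321 m n) a) \<longleftrightarrow>
      (\<exists>i \<in> {1..Suc (m + n)}. i = Suc m \<and> m = n)"
    unfolding has_fixed_point_iff length_infl321 by (rule bex_cong[OF refl]) (simp add: perm_at_infl321, linarith)
  then show ?thesis by simp
qed

section \<open>Defining fixed points\<close>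

text \<open>
  For \<open>L = PosLess\<close> and \<open>M = ValLess\<close>, \<open>at_least L M j 0\<close> says that the element assigned to
  the variable \<open>0\<close> has at least \<open>j\<close> elements to its upper left; exchanging the two orders gives the
  lower right. The witnesses are chosen in decreasing order, each below the previous one.
\<close>

primrec at_least :: "(nat \<Rightarrow> nat \<Rightarrow> toto) \<Rightarrow> (nat \<Rightarrow> nat \<Rightarrow> toto) \<Rightarrow> nat \<Rightarrow> nat \<Rightarrow> toto" where
  "at_least L M 0 z = Equal 0 0"
| "at_least L M (Suc j) z =
    Exists (Suc z) (Conj (L (Suc z) z) (Conj (M 0 (Suc z)) (at_least L M j (Suc z))))"

lemma free_vars_at_least:
  assumes "\<And>x y. free_vars (L x y) = {x, y}" "\<And>x y. free_vars (M x y) = {x, y}"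
  shows "free_vars (at_least L M j z) \<subseteq> {0, z}"
proof (induction j arbitrary: z)
  case (Suc j)
  show ?case using Suc[of "Suc z"] by (auto simp: assms)
qed simp

text \<open>This justifies the recursion of \<open>at_least\<close>: among the elements below
  \<open>t\<close>, the one with the largest \<open>f\<close>-value has all the others below it;
  conversely, \<open>a\<close> itself adds one to the count.\<close>

lemma Suc_le_card_below_iff:
  fixes f :: "'a \<Rightarrow> nat"
  assumes "finite A" "inj_on f A"
  shows "Suc j \<le> card {b \<in> A. f b < t} \<longleftrightarrow> (\<exists>a \<in> A. f a < t \<and> j \<le> card {b \<in> A. f b < f a})"
proof
  assume le: "Suc j \<le> card {b \<in> A. f b < t}"
  let ?S = "{b \<in> A. f b < t}"
  have "card ?S > 0" using le by linarith
  then have "finite ?S" "?S \<noteq> {}" by (auto simp only: card_gt_0_iff)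
  then have "Max (f ` ?S) \<in> f ` ?S" by (intro Max_in) auto
  then obtain a where a: "a \<in> ?S" "f a = Max (f ` ?S)" by auto
  have "f b < f a" if "b \<in> ?S" "b \<noteq> a" for b
  proof -
    have "f b \<le> f a" unfolding a(2) using \<open>finite ?S\<close> that by (intro Max_ge) auto
    moreover have "f b \<noteq> f a" using assms(2) that a(1) by (auto dest: inj_onD)
    ultimately show ?thesis by simp
  qed
  then have "?S - {a} \<subseteq> {b \<in> A. f b < f a}" by auto
  then have "card (?S - {a}) \<le> card {b \<in> A. f b < f a}"
    using assms(1) by (intro card_mono) auto
  then have "j \<le> card {b \<in> A. f b < f a}" using le a(1) \<open>finite ?S\<close> by simp
  then show "\<exists>a \<in> A. f a < t \<and> j \<le> card {b \<in> A. f b < f a}" using a(1) by auto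
next
  assume "\<exists>a \<in> A. f a < t \<and> j \<le> card {b \<in> A. f b < f a}"
  then obtain a where a: "a \<in> A" "f a < t" "j \<le> card {b \<in> A. f b < f a}" by blast
  have "card (insert a {b \<in> A. f b < f a}) \<le> card {b \<in> A. f b < t}"
    using assms(1) a by (intro card_mono) auto
  then show "Suc j \<le> card {b \<in> A. f b < t}" using a(3) assms(1) by simp
qed

text \<open>Witnesses go into the variables \<open>Suc z\<close>, so variable \<open>0\<close> is
  never overwritten and the bound \<open>m (v 0)\<close> stays fixed throughout the
  induction.\<close>

lemma sat_at_least_iff:
  fixes l m :: "nat \<times> nat \<Rightarrow> nat"
  assumes L: "\<And>v x y. sat \<sigma> v (L x y) \<longleftrightarrow> l (v x) < l (v y)"
    and M: "\<And>v x y. sat \<sigma> v (M x y) \<longleftrightarrow> m (v x) < m (v y)"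
    and inj: "inj_on l (elements \<sigma>)"
  shows "sat \<sigma> v (at_least L M j z) \<longleftrightarrow>
    j \<le> card {b \<in> elements \<sigma>. m (v 0) < m b \<and> l b < l (v z)}"
proof (induction j arbitrary: v z)
  case (Suc j)
  let ?A = "{b \<in> elements \<sigma>. m (v 0) < m b}"
  have "finite ?A" "inj_on l ?A" using inj by (auto simp: elements_eq intro: inj_on_subset)
  from Suc_le_card_below_iff[OF this, of j "l (v z)"] show ?case
    by (auto simp: Suc L M conj_assoc)
qed simp

text \<open>Equality of the two counts after truncation at \<open>K\<close>. Each biconditional
  becomes two negated conjunctions, and the true formula \<open>Equal 0 0\<close> keeps
  \<open>0\<close> free even for \<open>K = 0\<close>.\<close>

primrec equally_many :: "nat \<Rightarrow> toto" where
  "equally_many 0 = Equal 0 0"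
| "equally_many (Suc K) = Conj (equally_many K) (Conj
    (Neg (Conj (at_least PosLess ValLess (Suc K) 0) (Neg (at_least ValLess PosLess (Suc K) 0))))
    (Neg (Conj (at_least ValLess PosLess (Suc K) 0) (Neg (at_least PosLess ValLess (Suc K) 0)))))"

lemma free_vars_equally_many: "free_vars (equally_many K) = {0}"
proof (induction K)
  case (Suc K)
  have "free_vars (at_least PosLess ValLess (Suc K) 0) \<subseteq> {0}"
    "free_vars (at_least ValLess PosLess (Suc K) 0) \<subseteq> {0}"
    using free_vars_at_least[of PosLess ValLess "Suc K" 0] free_vars_at_least[of ValLess PosLess "Suc K" 0]
    by auto
  with Suc show ?case by (auto simp del: at_least.simps)
qed simp

section \<open>Counting points to the upper left and lower right\<close>

definition upper_left :: "nat list \<Rightarrow> nat \<Rightarrow> nat set" where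
  "upper_left \<sigma> i = {j \<in> {1..length \<sigma>}. j < i \<and> perm_at \<sigma> i < perm_at \<sigma> j}"

definition lower_right :: "nat list \<Rightarrow> nat \<Rightarrow> nat set" where
  "lower_right \<sigma> i = {j \<in> {1..length \<sigma>}. i < j \<and> perm_at \<sigma> j < perm_at \<sigma> i}"

lemma sat_equally_many_iff:
  assumes "is_perm \<sigma>" "v 0 = (i, perm_at \<sigma> i)"
  shows "sat \<sigma> v (equally_many K) \<longleftrightarrow>
    (\<forall>j \<le> K. j \<le> card (upper_left \<sigma> i) \<longleftrightarrow> j \<le> card (lower_right \<sigma> i))"
proof -
  have inj: "inj_on fst (elements \<sigma>)" "inj_on snd (elements \<sigma>)"
    using bij_betw_perm_at[OF assms(1)] by (auto simp: elements_eq inj_on_def bij_betw_def)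
  \<comment> \<open>Counts of elements are turned into counts of positions.\<close>
  have image: "{b \<in> elements \<sigma>. P b} = (\<lambda>j. (j, perm_at \<sigma> j)) ` {j \<in> {1..length \<sigma>}. P (j, perm_at \<sigma> j)}" for P
    by (auto simp: elements_eq)
  have card: "card {b \<in> elements \<sigma>. P b} = card {j \<in> {1..length \<sigma>}. P (j, perm_at \<sigma> j)}" for P
    unfolding image by (rule card_image) (auto simp: inj_on_def)
  have "sat \<sigma> v (at_least PosLess ValLess j 0) \<longleftrightarrow> j \<le> card (upper_left \<sigma> i)" for j
    using sat_at_least_iff[of \<sigma> PosLess fst ValLess snd v j 0] inj assms(2)
    by (simp add: card upper_left_def conj_commute)
  moreover have "sat \<sigma> v (at_least ValLess PosLess j 0) \<longleftrightarrow> j \<le> card (lower_right \<sigma> i)" for j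
    using sat_at_least_iff[of \<sigma> ValLess snd PosLess fst v j 0] inj assms(2)
    by (simp add: card lower_right_def)
  ultimately show ?thesis
    by (induction K) (auto simp: le_Suc_eq simp del: at_least.simps)
qed

text \<open>With \<open>W\<close> the points to the lower left, the \<open>i - 1\<close> positions
  before \<open>i\<close> split into \<open>W\<close> and \<open>upper_left\<close>, while the
  \<open>perm_at \<sigma> i - 1\<close> smaller values split into \<open>W\<close> and
  \<open>lower_right\<close>.\<close>

lemma fixed_iff_card_eq:
  assumes "is_perm \<sigma>" "i \<in> {1..length \<sigma>}"
  shows "perm_at \<sigma> i = i \<longleftrightarrow> card (upper_left \<sigma> i) = card (lower_right \<sigma> i)"
proof -
  let ?N = "length \<sigma>" and ?f = "perm_at \<sigma>"
  have bij: "bij_betw ?f {1..?N} {1..?N}" by (rule bij_betw_perm_at[OF assms(1)])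
  define W where "W = {j \<in> {1..?N}. j < i \<and> ?f j < ?f i}"
  have fi: "?f i \<in> {1..?N}" using bij assms(2) by (auto simp: bij_betw_def)
  have ne: "?f j \<noteq> ?f i" if "j \<in> {1..?N}" "j \<noteq> i" for j
    using bij assms(2) that by (auto simp: bij_betw_def dest: inj_onD)
  have "{1..<i} = W \<union> upper_left \<sigma> i" "W \<inter> upper_left \<sigma> i = {}"
    using assms(2) ne by (auto simp: W_def upper_left_def) (metis le_trans less_imp_le_nat nat_neq_iff)
  then have "card {1..<i} = card W + card (upper_left \<sigma> i)"
    by (simp add: card_Un_disjoint W_def upper_left_def)
  moreover have "{j \<in> {1..?N}. ?f j < ?f i} = W \<union> lower_right \<sigma> i" "W \<inter> lower_right \<sigma> i = {}"
    by (auto simp: W_def lower_right_def) (metis nat_neq_iff)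
  then have "card {j \<in> {1..?N}. ?f j < ?f i} = card W + card (lower_right \<sigma> i)"
    by (simp add: card_Un_disjoint W_def lower_right_def)
  moreover have "bij_betw ?f {j \<in> {1..?N}. ?f j < ?f i} {1..<?f i}"
  proof (rule bij_betw_subset[OF bij])
    show "?f ` {j \<in> {1..?N}. ?f j < ?f i} = {1..<?f i}"
    proof (intro equalityI subsetI)
      fix y assume "y \<in> {1..<?f i}"
      then have "y \<in> ?f ` {1..?N}" using bij fi by (auto simp: bij_betw_def)
      then show "y \<in> ?f ` {j \<in> {1..?N}. ?f j < ?f i}" using \<open>y \<in> {1..<?f i}\<close> by auto
    qed (use bij in \<open>auto simp: bij_betw_def\<close>)
  qed auto
  then have "card {j \<in> {1..?N}. ?f j < ?f i} = ?f i - 1" by (simp add: bij_betw_same_card)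
  ultimately show ?thesis using assms(2) fi by auto
qed

section \<open>Bounding one of the two regions\<close>

definition forces_monotone :: "nat \<Rightarrow> nat \<Rightarrow> nat \<Rightarrow> bool" where
  "forces_monotone r m k \<longleftrightarrow> (\<forall>(f :: nat \<Rightarrow> nat) S. finite S \<and> inj_on f S \<and> r \<le> card S \<longrightarrow>
    (\<exists>T \<subseteq> S. card T = m \<and> (\<forall>x \<in> T. \<forall>y \<in> T. x < y \<longrightarrow> f x < f y)) \<or>
    (\<exists>T \<subseteq> S. card T = k \<and> (\<forall>x \<in> T. \<forall>y \<in> T. x < y \<longrightarrow> f y < f x)))"

text \<open>Pairs on which \<open>f\<close> increases form the edges of a graph. A clique is then an
  increasing set, and by injectivity an independent set is a decreasing one.\<close>

lemma ex_forces_monotone: "\<exists>r. forces_monotone r m k"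
proof -
  obtain r where r: "\<And>(V :: nat set) E. finite V \<Longrightarrow> r \<le> card V \<Longrightarrow>
      \<exists>R \<subseteq> V. card R = m \<and> clique R E \<or> card R = k \<and> indep R E"
    using ramsey2[of m k] by metis
  have "forces_monotone r m k"
    unfolding forces_monotone_def
  proof (intro allI impI, elim conjE)
    fix f :: "nat \<Rightarrow> nat" and S
    assume S: "finite S" "inj_on f S" "r \<le> card S"
    define E where "E = {{x, y} | x y. x < y \<and> f x < f y}"
    have E: "{x, y} \<in> E \<longleftrightarrow> f x < f y" if "x < y" for x y
      using that by (auto simp: E_def doubleton_eq_iff)
    obtain T where "T \<subseteq> S" and T: "card T = m \<and> clique T E \<or> card T = k \<and> indep T E"
      using r[OF S(1,3)] by blast
    have "f x < f y" if "clique T E" "x \<in> T" "y \<in> T" "x < y" for x y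
      using that E[of x y] by (auto simp: clique_def)
    moreover have "f y < f x" if "indep T E" "x \<in> T" "y \<in> T" "x < y" for x y
    proof -
      have "\<not> f x < f y" using that E[of x y] by (auto simp: indep_def)
      moreover have "f x \<noteq> f y" using that S(2) \<open>T \<subseteq> S\<close> by (auto dest: inj_onD)
      ultimately show ?thesis by simp
    qed
    ultimately show "(\<exists>T \<subseteq> S. card T = m \<and> (\<forall>x \<in> T. \<forall>y \<in> T. x < y \<longrightarrow> f x < f y)) \<or>
        (\<exists>T \<subseteq> S. card T = k \<and> (\<forall>x \<in> T. \<forall>y \<in> T. x < y \<longrightarrow> f y < f x))"
      using T \<open>T \<subseteq> S\<close> by blast
  qed
  then show ?thesis ..
qed

lemma contains_deltaI:
  assumes T: "T \<subseteq> {1..length \<sigma>}" "card T = k"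
    and decr: "\<forall>x \<in> T. \<forall>y \<in> T. x < y \<longrightarrow> perm_at \<sigma> y < perm_at \<sigma> x"
  shows "contains_pattern \<sigma> (delta k)"
proof (rule contains_patternI[where ps = "sorted_list_of_set T"])
  have fin: "finite T" using T(1) by (rule finite_subset) simp
  then show "set (sorted_list_of_set T) \<subseteq> {1..length \<sigma>}" using T(1) by simp
  fix i j
  assume "i < length (delta k)" "j < length (delta k)"
  then have ij: "i < k" "j < k" by simp_all
  have less: "perm_at \<sigma> (sorted_list_of_set T ! b) < perm_at \<sigma> (sorted_list_of_set T ! a)"
    if "a < b" "b < k" for a b
    using that decr strict_sorted_list_of_set[of T] fin T(2)
      nth_mem[of a "sorted_list_of_set T"] nth_mem[of b "sorted_list_of_set T"]
    by (simp add: sorted_wrt_iff_nth_less)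
  show "perm_at \<sigma> (sorted_list_of_set T ! i) < perm_at \<sigma> (sorted_list_of_set T ! j) \<longleftrightarrow>
      delta k ! i < delta k ! j"
    using less[of i j] less[of j i] ij by (cases i j rule: linorder_cases) (simp_all add: nth_delta)
qed (use T in auto)

text \<open>The positions of \<open>S\<close> precede \<open>i\<close> and those of \<open>T\<close>
  follow it, with values above and below that of \<open>i\<close>; the sorted lists joined through
  \<open>i\<close> are therefore the required occurrence, its centre at list index
  \<open>m\<close>.\<close>

lemma contains_infl321I:
  assumes i: "i \<in> {1..length \<sigma>}"
    and S: "S \<subseteq> upper_left \<sigma> i" "card S = m" "\<forall>x \<in> S. \<forall>y \<in> S. x < y \<longrightarrow> perm_at \<sigma> x < perm_at \<sigma> y"
    and T: "T \<subseteq> lower_right \<sigma> i" "card T = n" "\<forall>x \<in> T. \<forall>y \<in> T. x < y \<longrightarrow> perm_at \<sigma> x < perm_at \<sigma> y"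
  shows "contains_pattern \<sigma> (infl321 m n)"
proof -
  let ?s = "sorted_list_of_set S" and ?t = "sorted_list_of_set T"
  let ?ps = "?s @ i # ?t" and ?f = "perm_at \<sigma>"
  have fin: "finite S" "finite T"
    using S(1) T(1) by (auto simp: upper_left_def lower_right_def intro: finite_subset)
  have len: "length ?s = m" "length ?t = n" using S(2) T(2) by simp_all
  have s: "?f i < ?f (?s ! a)" if "a < m" for a
    using that nth_mem[of a ?s] fin(1) len(1) S(1) by (auto simp: upper_left_def)
  have t: "?f (?t ! (a - Suc m)) < ?f i" if "m < a" "a < Suc (m + n)" for a
  proof -
    have "a - Suc m < n" using that by linarith
    then have "?t ! (a - Suc m) \<in> T" using nth_mem[of "a - Suc m" ?t] fin(2) len(2) by simp
    then show ?thesis using T(1) by (auto simp: lower_right_def)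
  qed
  have ss: "?f (?s ! a) < ?f (?s ! b)" if "a < b" "b < m" for a b
    using that S(3) strict_sorted_list_of_set[of S] fin(1) len(1) nth_mem[of a ?s] nth_mem[of b ?s]
    by (simp add: sorted_wrt_iff_nth_less)
  have tt: "?f (?t ! a) < ?f (?t ! b)" if "a < b" "b < n" for a b
    using that T(3) strict_sorted_list_of_set[of T] fin(2) len(2) nth_mem[of a ?t] nth_mem[of b ?t]
    by (simp add: sorted_wrt_iff_nth_less)
  show ?thesis
  proof (rule contains_patternI[where ps = ?ps])
    show "sorted_wrt (<) ?ps" "set ?ps \<subseteq> {1..length \<sigma>}"
      using i S(1) T(1) fin by (fastforce simp: sorted_wrt_append upper_left_def lower_right_def)+
    show "length ?ps = length (infl321 m n)" using len by simp
    fix a b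
    assume ab: "a < length (infl321 m n)" "b < length (infl321 m n)"
    have ss_iff: "?f (?s ! a) < ?f (?s ! b) \<longleftrightarrow> a < b" if "a < m" "b < m"
      using ss[of a b] ss[of b a] that by (cases a b rule: linorder_cases) simp_all
    have tt_iff: "?f (?t ! (a - Suc m)) < ?f (?t ! (b - Suc m)) \<longleftrightarrow> a < b" if "m < a" "m < b"
    proof -
      have "a - Suc m < b - Suc m \<longleftrightarrow> a < b" "b - Suc m < a - Suc m \<longleftrightarrow> b < a"
        "a - Suc m < n" "b - Suc m < n"
        using that ab unfolding length_infl321 by linarith+
      then show ?thesis
        using tt[of "a - Suc m" "b - Suc m"] tt[of "b - Suc m" "a - Suc m"]
        by (cases a b rule: linorder_cases) simp_all
    qed
    have ps: "?ps ! c = (if c < m then ?s ! c else if c = m then i else ?t ! (c - Suc m))" for c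
      using len by (simp add: nth_append nth_Cons')
    show "?f (?ps ! a) < ?f (?ps ! b) \<longleftrightarrow> infl321 m n ! a < infl321 m n ! b"
      using ab s[of a] s[of b] t[of a] t[of b] ss_iff tt_iff
      unfolding ps length_infl321
      by (cases a m rule: linorder_cases; cases b m rule: linorder_cases) (auto simp: nth_infl321)
  qed
qed

text \<open>If both regions were large, avoiding \<open>delta k\<close> would force an increasing
  set of size \<open>m\<close> in one and of size \<open>n\<close> in the other; together with
  \<open>i\<close> these form \<open>infl321 m n\<close>.\<close>

lemma ex_bound_card:
  assumes "delta k \<notin> C" "infl321 m n \<notin> C" "permutation_class C"
  obtains K where "\<And>\<sigma> i. \<sigma> \<in> C \<Longrightarrow> i \<in> {1..length \<sigma>} \<Longrightarrow>
    card (upper_left \<sigma> i) < K \<or> card (lower_right \<sigma> i) < K"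
proof -
  obtain r r' where r: "forces_monotone r m k" and r': "forces_monotone r' n k"
    using ex_forces_monotone by blast
  show thesis
  proof (rule that[of "max r r'"], rule ccontr)
    fix \<sigma> i
    assume \<sigma>: "\<sigma> \<in> C" and i: "i \<in> {1..length \<sigma>}"
      and "\<not> (card (upper_left \<sigma> i) < max r r' \<or> card (lower_right \<sigma> i) < max r r')"
    then have card: "r \<le> card (upper_left \<sigma> i)" "r' \<le> card (lower_right \<sigma> i)" by auto
    have closed: "\<pi> \<in> C" if "is_perm \<pi>" "contains_pattern \<sigma> \<pi>" for \<pi>
      using assms(3) \<sigma> that unfolding permutation_class_def by blast
    have inj: "inj_on (perm_at \<sigma>) {1..length \<sigma>}"
      using assms(3) \<sigma> bij_betw_perm_at unfolding permutation_class_def bij_betw_def by blast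
    have incr: "\<exists>T \<subseteq> A. card T = l \<and> (\<forall>x \<in> T. \<forall>y \<in> T. x < y \<longrightarrow> perm_at \<sigma> x < perm_at \<sigma> y)"
      if q: "forces_monotone q l k" "q \<le> card A" and A: "A \<subseteq> {1..length \<sigma>}" for q l A
    proof -
      have "finite A" "inj_on (perm_at \<sigma>) A"
        using A inj by (auto intro: finite_subset inj_on_subset)
      with q have "?thesis \<or>
          (\<exists>T \<subseteq> A. card T = k \<and> (\<forall>x \<in> T. \<forall>y \<in> T. x < y \<longrightarrow> perm_at \<sigma> y < perm_at \<sigma> x))"
        by (simp only: forces_monotone_def)
      then show ?thesis
      proof
        assume "\<exists>T \<subseteq> A. card T = k \<and> (\<forall>x \<in> T. \<forall>y \<in> T. x < y \<longrightarrow> perm_at \<sigma> y < perm_at \<sigma> x)"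
        then obtain T where T: "T \<subseteq> A" "card T = k"
          "\<forall>x \<in> T. \<forall>y \<in> T. x < y \<longrightarrow> perm_at \<sigma> y < perm_at \<sigma> x" by blast
        show ?thesis
          using closed[OF is_perm_delta contains_deltaI[OF subset_trans[OF T(1) A] T(2,3)]] assms(1) by simp
      qed
    qed
    have "upper_left \<sigma> i \<subseteq> {1..length \<sigma>}" by (auto simp: upper_left_def)
    from incr[OF r card(1) this] obtain S where S: "S \<subseteq> upper_left \<sigma> i" "card S = m"
        "\<forall>x \<in> S. \<forall>y \<in> S. x < y \<longrightarrow> perm_at \<sigma> x < perm_at \<sigma> y" by blast
    have "lower_right \<sigma> i \<subseteq> {1..length \<sigma>}" by (auto simp: lower_right_def)
    from incr[OF r' card(2) this] obtain T where T: "T \<subseteq> lower_right \<sigma> i" "card T = n"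
        "\<forall>x \<in> T. \<forall>y \<in> T. x < y \<longrightarrow> perm_at \<sigma> x < perm_at \<sigma> y" by blast
    show False
      using closed[OF is_perm_infl321 contains_infl321I[OF i S T]] assms(2) by simp
  qed
qed

section \<open>The equivalences\<close>

lemma sat_equally_many_iff_fixed_point:
  assumes "is_perm \<sigma>" "a \<in> elements \<sigma>" "v 0 = a"
    and "card (upper_left \<sigma> (fst a)) < K \<or> card (lower_right \<sigma> (fst a)) < K"
  shows "sat \<sigma> v (equally_many K) \<longleftrightarrow> is_fixed_point \<sigma> a"
proof -
  obtain i where i: "i \<in> {1..length \<sigma>}" "a = (i, perm_at \<sigma> i)" using assms(2) by (auto simp: elements_eq)
  \<comment> \<open>Testing \<open>j\<close> at the successor of the count below \<open>K\<close>
    bounds the other count by it; the successor of that other count is then a legal test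
    too.\<close>
  have eq: "(\<forall>j \<le> K. j \<le> x \<longleftrightarrow> j \<le> y) \<longleftrightarrow> x = y" if "x < K \<or> y < K" for x y :: nat
  proof
    assume *: "\<forall>j \<le> K. j \<le> x \<longleftrightarrow> j \<le> y"
    show "x = y"
      using *[rule_format, of "Suc x"] *[rule_format, of "Suc y"] that by linarith
  qed simp
  have "sat \<sigma> v (equally_many K) \<longleftrightarrow> card (upper_left \<sigma> i) = card (lower_right \<sigma> i)"
    using assms(3,4) i(2) by (simp add: sat_equally_many_iff[OF assms(1)] eq)
  then show ?thesis
    using fixed_iff_card_eq[OF assms(1) i(1)] assms(2) i(2) by (simp add: is_fixed_point_def)
qed

text \<open>Since \<open>x\<close> is the only free variable, one assignment sending
  \<open>x\<close> to \<open>a\<close> decides for all of them.\<close>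

lemma models_at_iff_sat:
  assumes "free_vars \<phi> = {x}" "v x = a"
  shows "models_at \<sigma> x a \<phi> \<longleftrightarrow> sat \<sigma> v \<phi>"
proof -
  have "sat \<sigma> w \<phi> \<longleftrightarrow> sat \<sigma> v \<phi>" if "w x = a" for w
    using assms that by (intro sat_cong) simp
  then show ?thesis unfolding models_at_def using assms(2) by blast
qed

theorem theorem5p3:
  fixes C :: "nat list set"
  assumes "permutation_class C"
  shows
    "((\<exists>\<psi>. is_sentence \<psi> \<and>
         (\<forall>\<sigma>\<in>C. models \<sigma> \<psi> \<longleftrightarrow> (\<exists>a \<in> elements \<sigma>. is_fixed_point \<sigma> a)))
      \<longleftrightarrow>
      (\<exists>\<phi> x. free_vars \<phi> = {x} \<and>
         (\<forall>\<sigma>\<in>C. \<forall>a \<in> elements \<sigma>. models_at \<sigma> x a \<phi> \<longleftrightarrow> is_fixed_point \<sigma> a)))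
     \<and>
     ((\<exists>\<phi> x. free_vars \<phi> = {x} \<and>
         (\<forall>\<sigma>\<in>C. \<forall>a \<in> elements \<sigma>. models_at \<sigma> x a \<phi> \<longleftrightarrow> is_fixed_point \<sigma> a))
      \<longleftrightarrow>
      (\<exists>k m n :: nat. k > 0 \<and> m > 0 \<and> n > 0 \<and>
         delta k \<notin> C \<and> inflation [3, 2, 1] [iota m, [1], iota n] \<notin> C))"
  (is "(?sentence \<longleftrightarrow> ?formula) \<and> (_ \<longleftrightarrow> ?avoid)")
proof -
  have "?sentence" if formula: "?formula"
  proof -
    obtain \<phi> x where \<phi>: "free_vars \<phi> = {x}"
      "\<And>\<sigma> a. \<sigma> \<in> C \<Longrightarrow> a \<in> elements \<sigma> \<Longrightarrow> models_at \<sigma> x a \<phi> \<longleftrightarrow> is_fixed_point \<sigma> a"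
      using formula by blast
    have "models \<sigma> (Exists x \<phi>) \<longleftrightarrow> (\<exists>a \<in> elements \<sigma>. is_fixed_point \<sigma> a)" if "\<sigma> \<in> C" for \<sigma>
    proof -
      have "sat \<sigma> (v(x := a)) \<phi> \<longleftrightarrow> is_fixed_point \<sigma> a" if "a \<in> elements \<sigma>" for v a
        using \<phi>(2)[OF \<open>\<sigma> \<in> C\<close> that] models_at_iff_sat[OF \<phi>(1), of "v(x := a)" a \<sigma>] by simp
      then show ?thesis by (simp add: models_def)
    qed
    moreover have "is_sentence (Exists x \<phi>)" using \<phi>(1) by (simp add: is_sentence_def)
    ultimately show ?thesis by blast
  qed
  moreover have "?avoid" if sentence: "?sentence"
  proof (rule ccontr)
    assume contra: "\<not> ?avoid"
    obtain \<psi> where \<psi>: "is_sentence \<psi>"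
      "\<And>\<sigma>. \<sigma> \<in> C \<Longrightarrow> models \<sigma> \<psi> \<longleftrightarrow> (\<exists>a \<in> elements \<sigma>. is_fixed_point \<sigma> a)"
      using sentence by blast
    \<comment> \<open>The threshold from which \<open>\<psi>\<close> separates neither pair.\<close>
    define k where "k = (2 :: nat) ^ qrank \<psi>"
    have "k > 0" by (simp add: k_def)
    show False
    proof (cases "\<forall>k > 0. delta k \<in> C")
      case True
      \<comment> \<open>Exactly one of \<open>k\<close> and \<open>Suc k\<close> is odd, so exactly
        one of these two has a fixed point.\<close>
      then have "delta k \<in> C" "delta (Suc k) \<in> C" using \<open>k > 0\<close> by auto
      then show False
        using models_delta_Suc_iff[OF \<psi>(1) eq_refl[OF k_def[symmetric]]]
        by (simp add: \<psi>(2) has_fixed_point_delta_iff)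
    next
      case False
      \<comment> \<open>Some \<open>delta\<close> of positive size is missing from \<open>C\<close>,
        so the failure of \<open>?avoid\<close> puts \<open>infl321 m n\<close> into
        \<open>C\<close> for all positive \<open>m\<close> and \<open>n\<close>.\<close>
      then have "infl321 k k \<in> C" "infl321 k (Suc k) \<in> C"
        using contra \<open>k > 0\<close> unfolding infl321_def by blast+
      then show False
        using models_infl321_Suc_iff[OF \<psi>(1) eq_refl[OF k_def[symmetric]]]
        by (simp add: \<psi>(2) has_fixed_point_infl321_iff)
    qed
  qed
  moreover have "?formula" if avoid: "?avoid"
  proof -
    obtain k m n where "delta k \<notin> C" "infl321 m n \<notin> C" using avoid unfolding infl321_def by blast
    from ex_bound_card[OF this assms] obtain K where K: "\<And>\<sigma> i. \<sigma> \<in> C \<Longrightarrow> i \<in> {1..length \<sigma>} \<Longrightarrow>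
        card (upper_left \<sigma> i) < K \<or> card (lower_right \<sigma> i) < K"
      by blast
    have "models_at \<sigma> 0 a (equally_many K) \<longleftrightarrow> is_fixed_point \<sigma> a" if "\<sigma> \<in> C" "a \<in> elements \<sigma>" for \<sigma> a
    proof -
      have "is_perm \<sigma>" using assms that(1) by (simp add: permutation_class_def)
      moreover have "card (upper_left \<sigma> (fst a)) < K \<or> card (lower_right \<sigma> (fst a)) < K"
        using K[OF that(1)] that(2) unfolding elements_eq by fastforce
      ultimately show ?thesis
        using sat_equally_many_iff_fixed_point that(2) models_at_iff_sat[OF free_vars_equally_many, of "\<lambda>_. a" a] by simp
    qed
    then show ?thesis using free_vars_equally_many by blast
  qed
  ultimately show ?thesis by blast
qed

end
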